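(* Let $X$ be a $W$-hyperbolic space, $C\subseteq X$ a convex subset, $T:C\to C$ a nonexpansive mapping with a fixed point $p$, $u,y_0\in C$, and $(\beta_n)_{n\in\mathbb N},(\lambda_n)_{n\in\mathbb N}$ sequences in $[0,1]$. Let $(y_n)$ be the modified Halpern iteration starting with $y_0$, and let $M\ge1$ be an integer with $M\ge4\max\{d(u,p),d(y_0,p)\}$. Assume that $\lim_{n\to\infty}\beta_n=1$ with rate of convergence $\sigma_4:\mathbb N\to\mathbb N$, and that $\Lambda\in\mathbb N$, $\Lambda\ge1$, and $N_\Lambda\in\mathbb N$ are such that $\lambda_n\ge\frac1\Lambda$ for all $n\ge N_\Lambda$. If $\Sigma:\mathbb N\to\mathbb N$ is a rate of asymptotic regularity of $(y_n)$, then $$\widehat\Sigma(k)=\max\{N_\Lambda,\ \Sigma(2\Lambda(k+1)-1),\ \sigma_4(2M\Lambda(k+1)-1)\}$$ is a rate of $T$-asymptotic regularity of $(y_n)$.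
   Context: A $W$-space is a metric space $(X,d)$ with a function $W:X\times X\times[0,1]\to X$; one writes $(1-\lambda)x+\lambda y$ for $W(x,y,\lambda)$. It is a $W$-hyperbolic space if for all $x,y,z,w\in X$ and $\lambda,\tilde\lambda\in[0,1]$: (W1) $d(z,(1-\lambda)x+\lambda y)\le(1-\lambda)d(z,x)+\lambda d(z,y)$; (W2) $d((1-\lambda)x+\lambda y,(1-\tilde\lambda)x+\tilde\lambda y)=|\lambda-\tilde\lambda|\,d(x,y)$; (W3) $(1-\lambda)x+\lambda y=\lambda y+(1-\lambda)x$, i.e. $W(x,y,\lambda)=W(y,x,1-\lambda)$; (W4) $d((1-\lambda)x+\lambda z,(1-\lambda)y+\lambda w)\le(1-\lambda)d(x,y)+\lambda d(z,w)$. A nonempty $C\subseteq X$ is convex if $(1-\lambda)x+\lambda y\in C$ for all $x,y\in C$, $\lambda\in[0,1]$. $T$ is nonexpansive if $d(Tx,Ty)\le d(x,y)$ for all $x,y\in C$. Modified Halpern iteration: $y_{n+1}=(1-\beta_{n+1})u+\beta_{n+1}v_n$ with $v_n=(1-\lambda_n)y_n+\lambda_nTy_n$. For a real sequence $a_n\to a$, a rate of convergence is $\varphi:\mathbb N\to\mathbb N$ with $|a_n-a|\le\frac1{k+1}$ for all $k\in\mathbb N$ and $n\ge\varphi(k)$. A rate of asymptotic regularity (resp. $T$-asymptotic regularity) of a sequence $(a_n)$ in $C$ is a rate of convergence of $(d(a_n,a_{n+1}))$ (resp. of $(d(a_n,Ta_n))$) to $0$. *)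

theory Defs
  imports "HOL-Analysis.Analysis"
begin

text \<open>\<open>W x y l\<close> stands for \<open>(1 - l) x + l y\<close>. It is a total function, but only its values at
  points of the carrier \<open>M\<close> and parameters in \<open>[0,1]\<close> are constrained or used.\<close>

locale W_space = Metric_space M d
  for M :: "'a set" and d :: "'a \<Rightarrow> 'a \<Rightarrow> real" +
  fixes W :: "'a \<Rightarrow> 'a \<Rightarrow> real \<Rightarrow> 'a"
  assumes W_closed: "\<lbrakk>x \<in> M; y \<in> M; l \<in> {0..1}\<rbrakk> \<Longrightarrow> W x y l \<in> M"

locale W_hyperbolic_space = W_space M d W
  for M :: "'a set" and d :: "'a \<Rightarrow> 'a \<Rightarrow> real" and W :: "'a \<Rightarrow> 'a \<Rightarrow> real \<Rightarrow> 'a" +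
  assumes W1: "\<lbrakk>x \<in> M; y \<in> M; z \<in> M; l \<in> {0..1}\<rbrakk> \<Longrightarrow>
                 d z (W x y l) \<le> (1 - l) * d z x + l * d z y"
    and W2: "\<lbrakk>x \<in> M; y \<in> M; l \<in> {0..1}; l' \<in> {0..1}\<rbrakk> \<Longrightarrow>
                 d (W x y l) (W x y l') = \<bar>l - l'\<bar> * d x y"
    and W3: "\<lbrakk>x \<in> M; y \<in> M; l \<in> {0..1}\<rbrakk> \<Longrightarrow> W x y l = W y x (1 - l)"
    and W4: "\<lbrakk>x \<in> M; y \<in> M; z \<in> M; w \<in> M; l \<in> {0..1}\<rbrakk> \<Longrightarrow>
                 d (W x z l) (W y w l) \<le> (1 - l) * d x y + l * d z w"

definition W_convex :: "'a set \<Rightarrow> ('a \<Rightarrow> 'a \<Rightarrow> real \<Rightarrow> 'a) \<Rightarrow> 'a set \<Rightarrow> bool" where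
  "W_convex M W C \<longleftrightarrow>
     C \<noteq> {} \<and> C \<subseteq> M \<and> (\<forall>x\<in>C. \<forall>y\<in>C. \<forall>l\<in>{0..1}. W x y l \<in> C)"

definition nonexpansive_on :: "('a \<Rightarrow> 'a \<Rightarrow> real) \<Rightarrow> 'a set \<Rightarrow> ('a \<Rightarrow> 'a) \<Rightarrow> bool" where
  "nonexpansive_on d C T \<longleftrightarrow> (\<forall>x\<in>C. \<forall>y\<in>C. d (T x) (T y) \<le> d x y)"

primrec modified_halpern ::
  "('a \<Rightarrow> 'a \<Rightarrow> real \<Rightarrow> 'a) \<Rightarrow> ('a \<Rightarrow> 'a) \<Rightarrow> 'a \<Rightarrow> (nat \<Rightarrow> real) \<Rightarrow> (nat \<Rightarrow> real) \<Rightarrow> 'a \<Rightarrow> nat \<Rightarrow> 'a"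
where
  "modified_halpern W T u \<beta> lam y0 0 = y0"
| "modified_halpern W T u \<beta> lam y0 (Suc n) =
     (let y = modified_halpern W T u \<beta> lam y0 n; v = W y (T y) (lam n)
      in W u v (\<beta> (Suc n)))"

definition rate_of_convergence :: "(nat \<Rightarrow> real) \<Rightarrow> real \<Rightarrow> (nat \<Rightarrow> nat) \<Rightarrow> bool" where
  "rate_of_convergence a l \<phi> \<longleftrightarrow> (\<forall>k. \<forall>n\<ge>\<phi> k. \<bar>a n - l\<bar> \<le> 1 / (real k + 1))"

text \<open>The convergence itself need not be required separately.\<close>

lemma rate_of_convergence_imp_LIMSEQ:
  assumes "rate_of_convergence a l \<phi>"
  shows "a \<longlonglongrightarrow> l"
proof (rule LIMSEQ_I)
  fix r :: real
  assume "0 < r"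
  then obtain k where k: "1 / (real k + 1) < r"
    using nat_approx_posE[of r] by (auto simp: add.commute)
  have "norm (a n - l) < r" if "n \<ge> \<phi> k" for n
    using assms that k by (fastforce simp: rate_of_convergence_def)
  then show "\<exists>no. \<forall>n\<ge>no. norm (a n - l) < r" by blast
qed

definition rate_of_asymptotic_regularity ::
  "('a \<Rightarrow> 'a \<Rightarrow> real) \<Rightarrow> (nat \<Rightarrow> 'a) \<Rightarrow> (nat \<Rightarrow> nat) \<Rightarrow> bool" where
  "rate_of_asymptotic_regularity d a \<phi> \<longleftrightarrow>
     rate_of_convergence (\<lambda>n. d (a n) (a (Suc n))) 0 \<phi>"

definition rate_of_T_asymptotic_regularity ::
  "('a \<Rightarrow> 'a \<Rightarrow> real) \<Rightarrow> ('a \<Rightarrow> 'a) \<Rightarrow> (nat \<Rightarrow> 'a) \<Rightarrow> (nat \<Rightarrow> nat) \<Rightarrow> bool" where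
  "rate_of_T_asymptotic_regularity d T a \<phi> \<longleftrightarrow>
     rate_of_convergence (\<lambda>n. d (a n) (T (a n))) 0 \<phi>"

end

theory Submission
  imports Defs
begin

text \<open>The fixed point keeps the iteration within distance \<open>K = max {d(u,p), d(y\<^sub>0,p)}\<close> of \<open>p\<close>, so
  \<open>d(y\<^bsub>n+1\<^esub>, v\<^sub>n) \<le> (1 - \<beta>\<^bsub>n+1\<^esub>) d(u, v\<^sub>n) \<le> 2K (1 - \<beta>\<^bsub>n+1\<^esub>)\<close>. By (W1),
  \<open>\<lambda>\<^sub>n d(y\<^sub>n, T y\<^sub>n) \<le> d(y\<^sub>n, v\<^sub>n) \<le> d(y\<^sub>n, y\<^bsub>n+1\<^esub>) + d(y\<^bsub>n+1\<^esub>, v\<^sub>n)\<close>; dividing by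
  \<open>\<lambda>\<^sub>n \<ge> 1/\<Lambda>\<close> gives the rate.\<close>

context W_hyperbolic_space
begin

lemma dist_W_right_le:
  assumes "x \<in> M" "y \<in> M" "l \<in> {0..1}"
  shows "d y (W x y l) \<le> (1 - l) * d x y"
  using W1[OF assms(1,2,2,3)] assms by (simp add: commute)

text \<open>The point \<open>W x y l\<close> lies within \<open>(1 - l) * d x y\<close> of
  \<open>y\<close>, so the triangle inequality leaves at least \<open>l * d x y\<close> for its
  distance to \<open>x\<close>. This is what turns a bound on one averaging step into a bound on
  \<open>d x (T x)\<close>.\<close>

lemma dist_W_left_ge:
  assumes "x \<in> M" "y \<in> M" "l \<in> {0..1}"
  shows "l * d x y \<le> d x (W x y l)"
proof -
  have "d x y \<le> d x (W x y l) + d (W x y l) y"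
    using triangle W_closed assms by blast
  moreover have "d (W x y l) y \<le> (1 - l) * d x y"
    using dist_W_right_le[OF assms] by (simp add: commute)
  ultimately show ?thesis by (simp add: algebra_simps)
qed

text \<open>Closed balls are convex, by (W1).\<close>

lemma dist_W_le:
  assumes "x \<in> M" "y \<in> M" "z \<in> M" "l \<in> {0..1}" "d z x \<le> r" "d z y \<le> r"
  shows "d z (W x y l) \<le> r"
proof -
  have "d z (W x y l) \<le> (1 - l) * d z x + l * d z y"
    using W1 assms by blast
  also have "\<dots> \<le> r"
    using assms by (intro convex_bound_le) auto
  finally show ?thesis .
qed

text \<open>The part of \<open>C\<close> in the closed ball of radius \<open>r\<close> around
  \<open>p\<close> is convex, contains \<open>u\<close> and \<open>y0\<close>, and is mapped into
  itself by \<open>T\<close> because \<open>T\<close> is nonexpansive and fixes \<open>p\<close>.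
  Both convex combinations of the iteration therefore stay in it.\<close>

lemma modified_halpern_bounded:
  assumes "W_convex M W C" "T \<in> C \<rightarrow> C" "nonexpansive_on d C T"
    and "p \<in> C" "T p = p" "u \<in> C" "y0 \<in> C"
    and "\<And>n. \<beta> n \<in> {0..1}" "\<And>n. lam n \<in> {0..1}"
    and "d p u \<le> r" "d p y0 \<le> r"
  defines "y \<equiv> modified_halpern W T u \<beta> lam y0"
  shows "y n \<in> C \<and> d p (y n) \<le> r"
    and "W (y n) (T (y n)) (lam n) \<in> C \<and> d p (W (y n) (T (y n)) (lam n)) \<le> r"
proof -
  have step: "W x (T x) (lam n) \<in> C \<and> d p (W x (T x) (lam n)) \<le> r"
    if "x \<in> C \<and> d p x \<le> r" for x n
  proof -
    have Tx: "T x \<in> C" using assms that by auto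
    moreover have "d p (T x) \<le> r"
      using assms that unfolding nonexpansive_on_def by (metis order_trans)
    ultimately show ?thesis
      using assms that unfolding W_convex_def by (auto intro!: dist_W_le)
  qed
  show y: "y n \<in> C \<and> d p (y n) \<le> r" for n
  proof (induction n)
    case 0
    then show ?case using assms by simp
  next
    case (Suc n)
    have "y (Suc n) = W u (W (y n) (T (y n)) (lam n)) (\<beta> (Suc n))"
      by (simp add: y_def Let_def)
    moreover note step[OF Suc.IH, of n]
    ultimately show ?case
      using assms(1,4,6,8,10) unfolding W_convex_def by (auto intro!: dist_W_le)
  qed
  show "W (y n) (T (y n)) (lam n) \<in> C \<and> d p (W (y n) (T (y n)) (lam n)) \<le> r"
    using step y by blast
qed

text \<open>The factor \<open>lam n\<close> stays on the left because it may be 0 here; a positive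
  lower bound enters only in the theorem.\<close>

lemma modified_halpern_residual_le:
  assumes "W_convex M W C" "T \<in> C \<rightarrow> C" "nonexpansive_on d C T"
    and "p \<in> C" "T p = p" "u \<in> C" "y0 \<in> C"
    and "\<And>n. \<beta> n \<in> {0..1}" "\<And>n. lam n \<in> {0..1}"
    and "d p u \<le> r" "d p y0 \<le> r"
  defines "y \<equiv> modified_halpern W T u \<beta> lam y0"
  shows "lam n * d (y n) (T (y n)) \<le> d (y n) (y (Suc n)) + 2 * r * (1 - \<beta> (Suc n))"
proof -
  define v where "v = W (y n) (T (y n)) (lam n)"
  note bounded = modified_halpern_bounded[where \<beta> = \<beta> and lam = lam and n = n, OF assms(1-11),
      folded y_def, folded v_def]
  have CM: "C \<subseteq> M" using assms(1) by (simp add: W_convex_def)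
  have in_M: "u \<in> M" "p \<in> M" "y n \<in> M" "T (y n) \<in> M" "v \<in> M"
    using CM bounded assms(2,4,6) by auto
  have y_Suc: "y (Suc n) = W u v (\<beta> (Suc n))"
    by (simp add: y_def v_def Let_def)
  have "lam n * d (y n) (T (y n)) \<le> d (y n) v"
    unfolding v_def using dist_W_left_ge in_M assms(9) by blast
  also have "\<dots> \<le> d (y n) (y (Suc n)) + d v (y (Suc n))"
    using triangle[of "y n" "y (Suc n)" v] in_M W_closed assms(8)
    by (auto simp: y_Suc commute)
  also have "d v (y (Suc n)) \<le> (1 - \<beta> (Suc n)) * d u v"
    unfolding y_Suc using dist_W_right_le in_M assms(8) by blast
  also have "\<dots> \<le> (1 - \<beta> (Suc n)) * (2 * r)"
  proof (rule mult_left_mono)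
    \<comment> \<open>Both \<open>u\<close> and \<open>v\<close> lie in the ball of radius
      \<open>r\<close> around \<open>p\<close>.\<close>
    have "d u v \<le> d u p + d p v"
      using triangle in_M by blast
    then show "d u v \<le> 2 * r"
      using bounded assms(10) by (simp add: commute)
  qed (use assms(8)[of "Suc n"] in simp)
  finally show ?thesis by (simp add: mult_ac)
qed

end

theorem proposition4p5:
  fixes X C :: "'a set" and d :: "'a \<Rightarrow> 'a \<Rightarrow> real" and W :: "'a \<Rightarrow> 'a \<Rightarrow> real \<Rightarrow> 'a"
    and T :: "'a \<Rightarrow> 'a" and p u y0 :: 'a and \<beta> lam :: "nat \<Rightarrow> real"
    and y :: "nat \<Rightarrow> 'a" and M \<Lambda> N\<^sub>\<Lambda> :: nat and \<sigma>\<^sub>4 \<Sigma> :: "nat \<Rightarrow> nat"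
  assumes "W_hyperbolic_space X d W"
    and "W_convex X W C"
    and "T \<in> C \<rightarrow> C"
    and "nonexpansive_on d C T"
    and "p \<in> C" and "T p = p"
    and "u \<in> C" and "y0 \<in> C"
    and "\<And>n. \<beta> n \<in> {0..1}" and "\<And>n. lam n \<in> {0..1}"
    and "y = modified_halpern W T u \<beta> lam y0"
    and "M \<ge> 1" and "real M \<ge> 4 * max (d u p) (d y0 p)"
    and "rate_of_convergence \<beta> 1 \<sigma>\<^sub>4"
    and "\<Lambda> \<ge> 1" and "\<And>n. n \<ge> N\<^sub>\<Lambda> \<Longrightarrow> lam n \<ge> 1 / real \<Lambda>"
    and "rate_of_asymptotic_regularity d y \<Sigma>"
  shows "rate_of_T_asymptotic_regularity d T y
           (\<lambda>k. max N\<^sub>\<Lambda> (max (\<Sigma> (2 * \<Lambda> * (k + 1) - 1)) (\<sigma>\<^sub>4 (2 * M * \<Lambda> * (k + 1) - 1))))"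
  unfolding rate_of_T_asymptotic_regularity_def rate_of_convergence_def
proof (intro allI impI)
  fix k n :: nat
  assume n: "n \<ge> max N\<^sub>\<Lambda> (max (\<Sigma> (2 * \<Lambda> * (k + 1) - 1)) (\<sigma>\<^sub>4 (2 * M * \<Lambda> * (k + 1) - 1)))"
  interpret W_hyperbolic_space X d W by fact
  define r where "r = max (d u p) (d y0 p)"
  define \<epsilon> where "\<epsilon> = 1 / (real k + 1)"
  have pos: "real M > 0" "real \<Lambda> > 0" "\<epsilon> > 0"
    using \<open>M \<ge> 1\<close> \<open>\<Lambda> \<ge> 1\<close> by (auto simp: \<epsilon>_def)
  \<comment> \<open>The \<open>- 1\<close> in the arguments of the rates cancels the
    \<open>+ 1\<close> in the definition of a rate, so the error is exactly
    \<open>\<epsilon> / m\<close>. As \<open>m \<ge> 1\<close>, the subtraction on naturals does not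
    truncate.\<close>
  have pred: "1 / (real (m * (k + 1) - 1) + 1) = \<epsilon> / real m" if "m \<ge> 1" for m
    using that by (simp add: \<epsilon>_def of_nat_diff Suc_le_eq algebra_simps)
  have "\<bar>d (y n) (y (Suc n)) - 0\<bar> \<le> 1 / (real (2 * \<Lambda> * (k + 1) - 1) + 1)"
    using assms(17) n unfolding rate_of_asymptotic_regularity_def rate_of_convergence_def by simp
  then have dy: "d (y n) (y (Suc n)) \<le> \<epsilon> / (2 * real \<Lambda>)"
    using pred[of "2 * \<Lambda>"] \<open>\<Lambda> \<ge> 1\<close> by simp
  \<comment> \<open>A rate controls all later indices, so the bound for \<open>n\<close> also covers
    \<open>Suc n\<close>.\<close>
  have "\<bar>\<beta> (Suc n) - 1\<bar> \<le> 1 / (real (2 * M * \<Lambda> * (k + 1) - 1) + 1)"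
    using assms(14) n unfolding rate_of_convergence_def by simp
  then have b: "1 - \<beta> (Suc n) \<le> \<epsilon> / (2 * real M * real \<Lambda>)"
    using pred[of "2 * M * \<Lambda>"] \<open>M \<ge> 1\<close> \<open>\<Lambda> \<ge> 1\<close> by simp
  have "d (y n) (T (y n)) / real \<Lambda> \<le> lam n * d (y n) (T (y n))"
    using mult_right_mono[OF assms(16)[of n], of "d (y n) (T (y n))"] n by simp
  also have "\<dots> \<le> d (y n) (y (Suc n)) + 2 * r * (1 - \<beta> (Suc n))"
    unfolding \<open>y = _\<close> using assms(2-10)
    by (intro modified_halpern_residual_le) (auto simp: r_def commute)
  \<comment> \<open>As \<open>r \<ge> 0\<close>, the choice of \<open>M\<close> gives
    \<open>2 * r \<le> M\<close>. The \<open>M\<close> in the argument of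
    \<open>\<sigma>\<^sub>4\<close> then cancels, and this term and \<open>dy\<close> each
    contribute half of \<open>\<epsilon> / \<Lambda>\<close>.\<close>
  also have "2 * r * (1 - \<beta> (Suc n)) \<le> real M * (\<epsilon> / (2 * real M * real \<Lambda>))"
  proof (rule mult_mono[OF _ b])
    show "2 * r \<le> real M"
      using assms(13) by (simp add: r_def[symmetric])
  qed (use assms(9)[of "Suc n"] in simp_all)
  also have "\<dots> = \<epsilon> / (2 * real \<Lambda>)"
    using pos by simp
  finally have "d (y n) (T (y n)) / real \<Lambda> \<le> \<epsilon> / real \<Lambda>"
    using dy by simp
  then have "d (y n) (T (y n)) \<le> \<epsilon>"
    using pos by (simp add: divide_le_cancel)
  then show "\<bar>d (y n) (T (y n)) - 0\<bar> \<le> 1 / (real k + 1)"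
    by (simp add: \<epsilon>_def)
qed

end
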